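(* Let $\mathcal{M}_n$ be an NPOMDP with injective noise function $f_n$, fix an action sequence $a_{1:T}$, and let $p(o_{1:T}\mid a_{1:T})$ and $p(o^n_{1:T}\mid a_{1:T})$ be the resulting distributions of clean and cluttered observation sequences. Let $q(o_t\mid o^n_t)$ range over Dirac denoising distributions and $q(o^n_t\mid o_t)$ range over Dirac noising distributions, and let $\mathcal{Q}$ be the solution set $$\mathcal{Q} := \mathop{\arg\min}_{q(o_t\mid o^n_t)}\ \min_{q(o^n_t\mid o_t)} \mathcal{L}_{\mathrm{KL}},$$ where $$\mathcal{L}_{\mathrm{KL}} = \mathrm{D}_{\mathrm{KL}}\Big(p(o^n_{1:T}\mid a_{1:T})\,q(o_{1:T}\mid o^n_{1:T})\ \Big\Vert\ p(o_{1:T}\mid a_{1:T})\,q(o^n_{1:T}\mid o_{1:T})\Big),$$ with $q(o_{1:T}\mid o^n_{1:T})=\prod_{t=1}^T q(o_t\mid o^n_t)$ and $q(o^n_{1:T}\mid o_{1:T})=\prod_{t=1}^T q(o^n_t\mid o_t)$. Then $\mathcal{Q}$ equals the set of posterior denoising distributions of the noise functions homogeneous to $f_n$ under $p(o_{1:T}\mid a_{1:T})$: $$\mathcal{Q} = \left\{ p(o_t\mid o^{n_i}_t)\ \middle|\ f_{n_i}\in \mathcal{H}^p_{f_n}\right\}.$$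
   Context: **NPOMDP.** A Noisy Partially-Observed Markov Decision Process is $\mathcal{M}_n=\langle \mathcal{S},\mathcal{O},\mathcal{A},\mathcal{T},\mathcal{R},\gamma,\rho_0,f_n\rangle$ with hidden state space $\mathcal{S}$, discrete observation space $\mathcal{O}$, action space $\mathcal{A}$, transition kernel $\mathcal{T}$, reward function $\mathcal{R}$, discount $\gamma$, initial state distribution $\rho_0$, and an injective noise function $f_n:\mathcal{O}\to\mathcal{O}$ mapping a clean observation $o_t$ to its cluttered version $o^n_t=f_n(o_t)$. Given an action sequence $a_{1:T}$, the joint distribution of clean observations, cluttered observations and rewards is $$p(o_{1:T},o^n_{1:T},r_{1:T}\mid a_{1:T})=\int\prod_{t=1}^T p(o^n_t\mid o_t)\,p(o_t\mid s_{\le t},a_{<t})\,p(r_t\mid s_{\le t},a_{<t})\,p(s_t\mid s_{<t},a_{<t})\,\mathrm{d}s_{1:T},$$ where $p(o^n_t\mid o_t)=\delta(o^n_t-f_n(o_t))$ is the noising distribution, i.e. the point mass at $f_n(o_t)$. Thus $p(o_{1:T}\mid a_{1:T})$ is a probability distribution on $\mathcal{O}^T$, and $p(o^n_{1:T}\mid a_{1:T})$ is its push-forward under applying $f_n$ coordinatewise. **Observation spaces.** With $a_{1:T}$ fixed, let $\mathcal{O}^c=\{o\in\mathcal{O}:\exists t,\ p(o_t=o\mid a_{1:T})>0\}$ and $\mathcal{O}^n=\{o\in\mathcal{O}:\exists t,\ p(o^n_t=o\mid a_{1:T})>0\}$ be the sets of clean and cluttered observations that can occur. Clean observations are regarded as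 elements of $\mathcal{O}^c$ and cluttered ones as elements of $\mathcal{O}^n$, and $f_n$ is regarded as a map $\mathcal{O}^c\to\mathcal{O}^n$, which is a bijection. Noise functions are injective maps defined on $\mathcal{O}^c$. **Homogeneous noise functions.** For a noise function $f_{n_i}$, write $o^{n_i}_t=f_{n_i}(o_t)$ and $p(o^{n_i}_{1:T}\mid o_{1:T})=\prod_t\delta(o^{n_i}_t-f_{n_i}(o_t))$, and let $p(o^{n_i}_{1:T}\mid a_{1:T})=\sum_{o_{1:T}}p(o_{1:T}\mid a_{1:T})\,p(o^{n_i}_{1:T}\mid o_{1:T})$. Two noise functions $f_{n_1},f_{n_2}$ are homogeneous under $p(o_{1:T}\mid a_{1:T})$, written $f_{n_1}\equiv_p f_{n_2}$, if $p(o^{n_1}_{1:T}\mid a_{1:T})=p(o^{n_2}_{1:T}\mid a_{1:T})$ as distributions of sequences. Put $\mathcal{H}^p_{f_n}=\{f_{n_i}: f_{n_i}\equiv_p f_n\}$. **Posterior denoising distribution.** The posterior denoising distribution $p(o_t\mid o^{n_i}_t)$ of a noise function $f_{n_i}$ is the conditional distribution of the clean observation given the cluttered observation, obtained by Bayes' rule from the prior on clean observations and the noising distribution of $f_{n_i}$. Since $f_{n_i}$ is injective, it is the kernel assigning to each cluttered observation $x$ in the image of $f_{n_i}$ the point mass at $f_{n_i}^{-1}(x)$. **Learnable distributions.** The denoising distribution is of the form $q(o_t\mid o^n_t)=\delta(o_t-m_{\mathrm{de}}(o^n_t))$ with an arbitrary function $m_{\mathrm{de}}:\mathcal{O}^n\to\mathcal{O}^c$,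 and the noising distribution is of the form $q(o^n_t\mid o_t)=\delta(o^n_t-m_{\mathrm{n}}(o_t))$ with an arbitrary function $m_{\mathrm{n}}:\mathcal{O}^c\to\mathcal{O}^n$. The same $m_{\mathrm{de}}$ and $m_{\mathrm{n}}$ are used for all $t$. Here $\delta$ denotes a point mass on a discrete set, and $\mathrm{D}_{\mathrm{KL}}$ takes values in $[0,\infty]$ and is between distributions on $(\mathcal{O}^c)^T\times(\mathcal{O}^n)^T$. *)

theory Defs
  imports "HOL-Probability.Probability"
begin

section \<open>Noisy partially observed Markov decision processes\<close>

text \<open>
  Time is counted from 0, so the usual indices 1, ..., T become 0, ..., T - 1. Actions are given by
  a function \<open>a\<close> on time, of which only the values below the horizon are used; \<open>map a [0..<t]\<close> is
  the action history before time t, and its length tells a kernel at which time it is applied.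
  State histories are elements of a finite product space. The observation space is the countable
  type \<open>'o\<close>, the action space is the type \<open>'a\<close>. The kernels may depend on the whole history,
  as in p(s_t | s_{<t}, a_{<t}), p(o_t | s_{<=t}, a_{<t}) and p(r_t | s_{<=t}, a_{<t}); Markovian
  transitions and deterministic rewards are the special cases of kernels that depend on the most
  recent state and action only, and of point masses.
\<close>

record ('s, 'o, 'a) npomdp =
  state_space :: "'s measure"
  transition :: "'a list \<Rightarrow> (nat \<Rightarrow> 's) \<Rightarrow> 's measure"
  observation :: "'a list \<Rightarrow> (nat \<Rightarrow> 's) \<Rightarrow> 'o pmf"
  reward :: "'a list \<Rightarrow> (nat \<Rightarrow> 's) \<Rightarrow> real measure"
  discount :: real
  initial :: "'s measure"
  noise :: "'o \<Rightarrow> 'o"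

definition valid_npomdp :: "('s, 'o::countable, 'a) npomdp \<Rightarrow> bool" where
  "valid_npomdp M \<longleftrightarrow>
    initial M \<in> space (prob_algebra (state_space M)) \<and>
    (\<forall>h. h \<noteq> [] \<longrightarrow> transition M h \<in>
       PiM {0..<length h} (\<lambda>_. state_space M) \<rightarrow>\<^sub>M prob_algebra (state_space M)) \<and>
    (\<forall>h. (\<lambda>s. measure_pmf (observation M h s)) \<in>
       PiM {0..<Suc (length h)} (\<lambda>_. state_space M) \<rightarrow>\<^sub>M prob_algebra (count_space UNIV)) \<and>
    (\<forall>h. reward M h \<in>
       PiM {0..<Suc (length h)} (\<lambda>_. state_space M) \<rightarrow>\<^sub>M prob_algebra borel) \<and>
    0 \<le> discount M \<and> discount M \<le> 1 \<and>
    inj (noise M)"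

definition next_state ::
  "('s, 'o, 'a) npomdp \<Rightarrow> (nat \<Rightarrow> 'a) \<Rightarrow> nat \<Rightarrow> (nat \<Rightarrow> 's) \<Rightarrow> 's measure" where
  "next_state M a t s = (if t = 0 then initial M else transition M (map a [0..<t]) s)"

text \<open>The law of the states below the horizon, i.e. the composition of the first T kernels.\<close>

definition state_dist :: "('s, 'o, 'a) npomdp \<Rightarrow> (nat \<Rightarrow> 'a) \<Rightarrow> nat \<Rightarrow> (nat \<Rightarrow> 's) measure" where
  "state_dist M a T = Ionescu_Tulcea.C (next_state M a) (\<lambda>_. state_space M) 0 T (\<lambda>_. undefined)"

definition dirac :: "('x \<Rightarrow> 'y) \<Rightarrow> 'x \<Rightarrow> 'y pmf" where
  "dirac f x = return_pmf (f x)"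

text \<open>The joint law of clean observation, cluttered observation and reward at one time.\<close>

definition emission ::
  "('s, 'o, 'a) npomdp \<Rightarrow> 'a list \<Rightarrow> (nat \<Rightarrow> 's) \<Rightarrow> (('o \<times> 'o) \<times> real) measure" where
  "emission M h s =
     measure_pmf (bind_pmf (observation M h s) (\<lambda>x. map_pmf (Pair x) (dirac (noise M) x)))
       \<Otimes>\<^sub>M reward M h s"

abbreviation emission_space :: "(('o \<times> 'o) \<times> real) measure" where
  "emission_space \<equiv> count_space UNIV \<Otimes>\<^sub>M borel"

text \<open>
  The joint law of all clean observations, cluttered observations and rewards given the actions.
  Given the states, the emissions at different times are independent; the states are integrated
  out by the monadic bind.
\<close>

definition trajectory_dist ::
  "('s, 'o, 'a) npomdp \<Rightarrow> (nat \<Rightarrow> 'a) \<Rightarrow> nat \<Rightarrow> (nat \<Rightarrow> ('o \<times> 'o) \<times> real) measure" where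
  "trajectory_dist M a T = state_dist M a T \<bind>
     (\<lambda>s. PiM {0..<T} (\<lambda>t. emission M (map a [0..<t]) (restrict s {0..<Suc t})))"

text \<open>
  Observation sequences are lists of length T, and sequence distributions are the corresponding
  marginals of the joint law, converted to the type of discrete distributions. The lemmas
  \<open>measure_pmf_clean_dist\<close> and \<open>cluttered_dist_eq\<close> below show that this conversion is sound.
\<close>

definition clean_dist :: "('s, 'o, 'a) npomdp \<Rightarrow> (nat \<Rightarrow> 'a) \<Rightarrow> nat \<Rightarrow> 'o list pmf" where
  "clean_dist M a T = Abs_pmf (distr (trajectory_dist M a T) (count_space UNIV)
     (\<lambda>\<omega>. map (\<lambda>t. fst (fst (\<omega> t))) [0..<T]))"

definition cluttered_dist :: "('s, 'o, 'a) npomdp \<Rightarrow> (nat \<Rightarrow> 'a) \<Rightarrow> nat \<Rightarrow> 'o list pmf" where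
  "cluttered_dist M a T = Abs_pmf (distr (trajectory_dist M a T) (count_space UNIV)
     (\<lambda>\<omega>. map (\<lambda>t. snd (fst (\<omega> t))) [0..<T]))"


section \<open>Observation spaces and noise functions\<close>

definition marginal :: "nat \<Rightarrow> 'x list pmf \<Rightarrow> 'x pmf" where
  "marginal t p = map_pmf (\<lambda>xs. xs ! t) p"

definition occurring :: "nat \<Rightarrow> 'x list pmf \<Rightarrow> 'x set" where
  "occurring T p = {x. \<exists>t<T. pmf (marginal t p) x > 0}"

text \<open>The product over t of a kernel, e.g. the product of the q(o_t | o^n_t).\<close>

definition seq_kernel :: "('x \<Rightarrow> 'y pmf) \<Rightarrow> 'x list \<Rightarrow> 'y list pmf" where
  "seq_kernel q xs = map_pmf (\<lambda>g. map g [0..<length xs])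
     (Pi_pmf {0..<length xs} undefined (\<lambda>i. q (xs ! i)))"

definition noised_dist :: "'o list pmf \<Rightarrow> ('o \<Rightarrow> 'o) \<Rightarrow> 'o list pmf" where
  "noised_dist p f = bind_pmf p (seq_kernel (dirac f))"

text \<open>
  Maps and kernels on a subset of a type are represented by functions that are \<open>undefined\<close> outside
  of this subset, so that equality of functions is equality on the subset.
\<close>

definition noise_functions :: "nat \<Rightarrow> 'o list pmf \<Rightarrow> ('o \<Rightarrow> 'o) set" where
  "noise_functions T p = {f \<in> extensional (occurring T p). inj_on f (occurring T p)}"

definition homogeneous :: "'o list pmf \<Rightarrow> ('o \<Rightarrow> 'o) \<Rightarrow> ('o \<Rightarrow> 'o) \<Rightarrow> bool" where
  "homogeneous p f g \<longleftrightarrow> noised_dist p f = noised_dist p g"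

definition homogeneous_noise :: "nat \<Rightarrow> 'o list pmf \<Rightarrow> ('o \<Rightarrow> 'o) \<Rightarrow> ('o \<Rightarrow> 'o) set" where
  "homogeneous_noise T p f = {g \<in> noise_functions T p. homogeneous p g f}"

text \<open>
  A single kernel q, defined on the image of f and used for all times, that is given by Bayes' rule
  at every time t and for every cluttered observation x of positive probability at t. The lemma
  \<open>is_posterior_denoising_iff\<close> below shows that for an injective f there is exactly one such kernel.
\<close>

definition is_posterior_denoising ::
  "nat \<Rightarrow> 'o list pmf \<Rightarrow> ('o \<Rightarrow> 'o) \<Rightarrow> ('o \<Rightarrow> 'o pmf) \<Rightarrow> bool" where
  "is_posterior_denoising T p f q \<longleftrightarrow>
     q \<in> extensional (f ` occurring T p) \<and>
     (\<forall>t<T. \<forall>x. pmf (marginal t (noised_dist p f)) x > 0 \<longrightarrow>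
        (\<forall>y. pmf (q x) y =
           pmf (marginal t p) y * pmf (dirac f y) x / pmf (marginal t (noised_dist p f)) x))"


section \<open>The objective\<close>

text \<open>
  The relative entropy of P with respect to Q, in nats. The library's \<open>KL_divergence\<close> has its
  arguments in the opposite order, and is a meaningless real number if P is not absolutely
  continuous with respect to Q or if the integral is infinite. The negative part of the integrand
  is always integrable, so the integral is infinite exactly if the integrand is not integrable.
\<close>

definition KL_div :: "'x pmf \<Rightarrow> 'x pmf \<Rightarrow> ereal" where
  "KL_div P Q =
     (if absolutely_continuous (measure_pmf Q) (measure_pmf P) \<and>
         integrable (measure_pmf P) (entropy_density (exp 1) (measure_pmf Q) (measure_pmf P))
      then ereal (KL_divergence (exp 1) (measure_pmf Q) (measure_pmf P)) else \<infinity>)"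

text \<open>
  Here p and p' are the clean and the cluttered sequence distribution, q is the denoising and
  r the noising kernel. Pairs consist of a clean and a cluttered sequence, in this order.
\<close>

definition KL_loss ::
  "'o list pmf \<Rightarrow> 'o list pmf \<Rightarrow> ('o \<Rightarrow> 'o pmf) \<Rightarrow> ('o \<Rightarrow> 'o pmf) \<Rightarrow> ereal" where
  "KL_loss p p' q r = KL_div
     (bind_pmf p' (\<lambda>ys. map_pmf (\<lambda>xs. (xs, ys)) (seq_kernel q ys)))
     (bind_pmf p (\<lambda>xs. map_pmf (\<lambda>ys. (xs, ys)) (seq_kernel r xs)))"

definition dirac_kernels :: "'x set \<Rightarrow> 'y set \<Rightarrow> ('x \<Rightarrow> 'y pmf) set" where
  "dirac_kernels X Y = {restrict (dirac m) X | m. m \<in> X \<rightarrow> Y}"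

text \<open>
  The infimum over the noising kernels is a minimum: for a fixed q, the loss is infinite unless r
  inverts q on the cluttered observations, and then it does not depend on r.
\<close>

definition solution_set :: "nat \<Rightarrow> 'o list pmf \<Rightarrow> 'o list pmf \<Rightarrow> ('o \<Rightarrow> 'o pmf) set" where
  "solution_set T p p' =
     {q. is_arg_min (\<lambda>q. INF r \<in> dirac_kernels (occurring T p) (occurring T p'). KL_loss p p' q r)
           (\<lambda>q. q \<in> dirac_kernels (occurring T p') (occurring T p)) q}"


section \<open>Soundness of the definitions\<close>

lemma seq_kernel_dirac: "seq_kernel (dirac f) xs = return_pmf (map f xs)"
proof -
  have "Pi_pmf {0..<length xs} undefined (\<lambda>i. dirac f (xs ! i)) =
      return_pmf (\<lambda>i. if i \<in> {0..<length xs} then f (xs ! i) else undefined)"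
    unfolding dirac_def by (rule Pi_pmf_return_pmf) simp
  then show ?thesis
    by (auto simp: seq_kernel_def intro: nth_equalityI)
qed

lemma noised_dist_eq: "noised_dist p f = map_pmf (map f) p"
  unfolding noised_dist_def map_pmf_def by (intro bind_pmf_cong refl seq_kernel_dirac)

lemma marginal_noised_dist:
  assumes "\<And>xs. xs \<in> set_pmf p \<Longrightarrow> length xs = T" "t < T"
  shows "marginal t (noised_dist p f) = map_pmf f (marginal t p)"
  unfolding marginal_def noised_dist_eq pmf.map_comp
  by (rule map_pmf_cong) (use assms in auto)

lemma is_posterior_denoising_iff:
  assumes len: "\<And>xs. xs \<in> set_pmf p \<Longrightarrow> length xs = T"
    and inj: "inj_on f (occurring T p)"
  shows "is_posterior_denoising T p f q \<longleftrightarrow>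
    q = (\<lambda>x\<in>f ` occurring T p. return_pmf (inv_into (occurring T p) f x))"
proof -
  let ?O = "occurring T p" and ?p = "\<lambda>t. marginal t p" and ?n = "\<lambda>t. marginal t (noised_dist p f)"
  have supp: "x \<in> ?O" if "t < T" "x \<in> set_pmf (?p t)" for t x
    using that by (auto simp: occurring_def pmf_positive_iff)
  have n: "?n t = map_pmf f (?p t)" if "t < T" for t
    using marginal_noised_dist[OF len that] .
  have bayes: "pmf (?p t) y * pmf (dirac f y) (f z) / pmf (?n t) (f z) = pmf (return_pmf z) y"
    if t: "t < T" and z: "z \<in> ?O" and pos: "pmf (?n t) (f z) > 0" for t y z
  proof -
    have "pmf (?n t) (f z) = measure (?p t) (f -` {f z})"
      using n[OF t] by (simp add: pmf_map)
    also have "\<dots> = measure (?p t) {z}"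
      using inj z supp[OF t] by (intro measure_pmf.finite_measure_eq_AE) (auto simp: AE_measure_pmf_iff inj_on_def)
    finally have eq: "pmf (?n t) (f z) = pmf (?p t) z"
      by (simp add: measure_pmf_single)
    show ?thesis
    proof (cases "y = z")
      case True
      then show ?thesis using eq pos by (simp add: dirac_def)
    next
      case False
      then have "pmf (?p t) y = 0 \<or> f y \<noteq> f z"
        using inj z supp[OF t, of y] by (auto simp: set_pmf_iff inj_on_def)
      then show ?thesis using False by (auto simp: dirac_def)
    qed
  qed
  have image: "\<exists>t<T. pmf (?n t) x > 0" if "x \<in> f ` ?O" for x
    using that n by (fastforce simp: occurring_def pmf_positive_iff)
  have image': "x \<in> f ` ?O" if "t < T" "pmf (?n t) x > 0" for t x
    using that n supp by (auto simp: pmf_positive_iff)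
  show ?thesis
  proof
    assume post: "is_posterior_denoising T p f q"
    show "q = (\<lambda>x\<in>f ` ?O. return_pmf (inv_into ?O f x))"
    proof (rule extensionalityI)
      show "q \<in> extensional (f ` ?O)"
        using post by (simp add: is_posterior_denoising_def)
      fix x assume "x \<in> f ` ?O"
      then obtain z where z: "z \<in> ?O" "x = f z" by blast
      obtain t where t: "t < T" "pmf (?n t) x > 0"
        using image[OF \<open>x \<in> f ` ?O\<close>] by blast
      have "pmf (q x) y = pmf (return_pmf z) y" for y
        using post t bayes[of t z y] z unfolding is_posterior_denoising_def by metis
      then show "q x = (\<lambda>x\<in>f ` ?O. return_pmf (inv_into ?O f x)) x"
        using z inj by (auto intro: pmf_eqI)
    qed auto
  next
    assume "q = (\<lambda>x\<in>f ` ?O. return_pmf (inv_into ?O f x))"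
    then show "is_posterior_denoising T p f q"
      unfolding is_posterior_denoising_def using image' bayes inj by fastforce
  qed
qed

lemma PiM_kernel:
  assumes K: "\<And>i. i \<in> I \<Longrightarrow> K i \<in> X \<rightarrow>\<^sub>M prob_algebra (N i)" and I: "finite I"
  shows "(\<lambda>x. PiM I (\<lambda>i. K i x)) \<in> X \<rightarrow>\<^sub>M prob_algebra (PiM I N)"
proof (rule measurable_prob_algebra_generated[OF sets_PiM Int_stable_prod_algebra
      prod_algebra_sets_into_space])
  have K': "prob_space (K i x)" "sets (K i x) = sets (N i)" if "i \<in> I" "x \<in> space X" for i x
    using measurable_space[OF K] that by (auto simp: space_prob_algebra)
  show "prob_space (PiM I (\<lambda>i. K i x))" if "x \<in> space X" for x
    using K' that by (intro prob_space_PiM)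
  show "sets (PiM I (\<lambda>i. K i x)) = sets (PiM I N)" if "x \<in> space X" for x
    using K' that by (intro sets_PiM_cong) auto
  fix A assume "A \<in> prod_algebra I N"
  then obtain Y where A: "A = PiE I Y" and "Y \<in> (\<Pi> i\<in>I. sets (N i))"
    using prod_algebra_eq_finite[OF I, of N] by auto
  then have Y: "Y i \<in> sets (N i)" if "i \<in> I" for i
    using that by blast
  have "emeasure (PiM I (\<lambda>i. K i x)) A = (\<Prod>i\<in>I. emeasure (K i x) (Y i))"
    if x: "x \<in> space X" for x
  proof -
    define L where "L i = (if i \<in> I then K i x else return (count_space UNIV) undefined)" for i
    interpret product_prob_space L
      using K' x by (intro product_prob_spaceI) (auto simp: L_def intro!: prob_space_return)
    have "PiM I (\<lambda>i. K i x) = PiM I L" by (rule PiM_cong) (auto simp: L_def)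
    moreover have "emeasure (PiM I L) (PiE I Y) = (\<Prod>i\<in>I. emeasure (L i) (Y i))"
      using I K' x Y by (intro emeasure_PiM) (auto simp: L_def)
    ultimately show ?thesis using A by (simp add: L_def)
  qed
  moreover have "(\<lambda>x. \<Prod>i\<in>I. emeasure (K i x) (Y i)) \<in> borel_measurable X"
    using measurable_prob_algebraD[OF K] Y by (intro borel_measurable_prod_ennreal)
      (auto intro: measurable_compose[OF _ measurable_emeasure_subprob_algebra])
  ultimately show "(\<lambda>x. emeasure (PiM I (\<lambda>i. K i x)) A) \<in> borel_measurable X"
    by (subst measurable_cong) auto
qed

lemma state_dist_in:
  assumes "valid_npomdp M"
  shows "state_dist M a T \<in> space (prob_algebra (PiM {0..<T} (\<lambda>_. state_space M)))"
proof -
  let ?S = "state_space M"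
  have K: "next_state M a t \<in> PiM {0..<t} (\<lambda>_. ?S) \<rightarrow>\<^sub>M prob_algebra ?S" for t
  proof (cases "t = 0")
    case True
    then show ?thesis using assms by (simp add: next_state_def[abs_def] valid_npomdp_def)
  next
    case False
    have "\<forall>h. h \<noteq> [] \<longrightarrow> transition M h \<in>
        PiM {0..<length h} (\<lambda>_. ?S) \<rightarrow>\<^sub>M prob_algebra ?S"
      using assms unfolding valid_npomdp_def by (elim conjE)
    from this[rule_format, of "map a [0..<t]"] False
    have "transition M (map a [0..<t]) \<in> PiM {0..<t} (\<lambda>_. ?S) \<rightarrow>\<^sub>M prob_algebra ?S"
      by simp
    then show ?thesis using False by (simp add: next_state_def[abs_def])
  qed
  interpret Ionescu_Tulcea "next_state M a" "\<lambda>_. ?S"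
  proof (rule Ionescu_Tulcea.intro)
    show "next_state M a t \<in> PiM {0..<t} (\<lambda>_. ?S) \<rightarrow>\<^sub>M subprob_algebra ?S" for t
      by (rule measurable_prob_algebraD[OF K])
    show "prob_space (next_state M a t s)" if "s \<in> space (PiM {0..<t} (\<lambda>_. ?S))" for t s
      using measurable_space[OF K that] by (simp add: space_prob_algebra)
  qed
  have "(\<lambda>_. undefined) \<in> space (PiM {0..<0::nat} (\<lambda>_. ?S))"
    by (auto simp: space_PiM)
  from prob_space_C[OF this] sets_C[OF this] show ?thesis
    by (simp add: state_dist_def space_prob_algebra)
qed

lemma emission_in:
  fixes M :: "('s, 'o::countable, 'a) npomdp"
  assumes "valid_npomdp M"
  shows "emission M h \<in>
    PiM {0..<Suc (length h)} (\<lambda>_. state_space M) \<rightarrow>\<^sub>M prob_algebra emission_space"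
proof -
  let ?X = "PiM {0..<Suc (length h)} (\<lambda>_. state_space M)"
  have o: "(\<lambda>s. measure_pmf (observation M h s)) \<in> ?X \<rightarrow>\<^sub>M prob_algebra (count_space UNIV)"
    and r: "reward M h \<in> ?X \<rightarrow>\<^sub>M prob_algebra borel"
    using assms by (auto simp: valid_npomdp_def)
  have "(\<lambda>s. measure_pmf (bind_pmf (observation M h s) (\<lambda>x. map_pmf (Pair x) (dirac (noise M) x)))) =
      (\<lambda>s. distr (measure_pmf (observation M h s)) (count_space UNIV) (\<lambda>x. (x, noise M x)))"
    by (simp add: dirac_def map_pmf_rep_eq flip: map_pmf_def)
  then have "(\<lambda>s. measure_pmf (bind_pmf (observation M h s) (\<lambda>x. map_pmf (Pair x) (dirac (noise M) x))))
      \<in> ?X \<rightarrow>\<^sub>M prob_algebra (count_space UNIV)"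
    using measurable_compose[OF o measurable_distr_prob_space[of "\<lambda>x. (x, noise M x)" _ "count_space UNIV"]]
    by simp
  then show ?thesis
    unfolding emission_def[abs_def] by (intro measurable_pair_prob r)
qed

lemma emissions_in:
  fixes M :: "('s, 'o::countable, 'a) npomdp"
  assumes "valid_npomdp M"
  shows "(\<lambda>s. PiM {0..<T} (\<lambda>t. emission M (map a [0..<t]) (restrict s {0..<Suc t}))) \<in>
    PiM {0..<T} (\<lambda>_. state_space M) \<rightarrow>\<^sub>M prob_algebra (PiM {0..<T} (\<lambda>_. emission_space))"
proof (rule PiM_kernel)
  fix t assume t: "t \<in> {0..<T}"
  have "(\<lambda>s. restrict s {0..<Suc t}) \<in>
      PiM {0..<T} (\<lambda>_. state_space M) \<rightarrow>\<^sub>M PiM {0..<Suc t} (\<lambda>_. state_space M)"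
    using t by (intro measurable_restrict_subset) auto
  moreover have "emission M (map a [0..<t]) \<in>
      PiM {0..<Suc t} (\<lambda>_. state_space M) \<rightarrow>\<^sub>M prob_algebra emission_space"
    using emission_in[OF assms, of "map a [0..<t]"] by simp
  ultimately show "(\<lambda>s. emission M (map a [0..<t]) (restrict s {0..<Suc t})) \<in>
      PiM {0..<T} (\<lambda>_. state_space M) \<rightarrow>\<^sub>M prob_algebra emission_space"
    by (rule measurable_compose)
qed simp

lemma trajectory_dist_in:
  fixes M :: "('s, 'o::countable, 'a) npomdp"
  assumes "valid_npomdp M"
  shows "trajectory_dist M a T \<in> space (prob_algebra (PiM {0..<T} (\<lambda>_. emission_space)))"
  unfolding trajectory_dist_def
  using prob_space_bind'[OF state_dist_in[OF assms] emissions_in[OF assms]]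
    sets_bind'[OF state_dist_in[OF assms] emissions_in[OF assms]]
  by (simp add: space_prob_algebra)

lemma measurable_observations:
  fixes g :: "'o \<times> 'o \<Rightarrow> 'o::countable"
  shows "(\<lambda>\<omega>. map (\<lambda>t. g (fst (\<omega> t))) [0..<T]) \<in>
    PiM {0..<T} (\<lambda>_. emission_space) \<rightarrow>\<^sub>M count_space UNIV"
proof -
  have "(\<lambda>\<omega>. map (\<lambda>t. g (fst (\<omega> t))) ts) \<in>
      PiM {0..<T} (\<lambda>_. emission_space) \<rightarrow>\<^sub>M count_space UNIV"
    if "set ts \<subseteq> {0..<T}" for ts
    using that
  proof (induction ts)
    case (Cons t ts)
    have [measurable]: "(\<lambda>\<omega>. \<omega> t) \<in> PiM {0..<T} (\<lambda>_. emission_space) \<rightarrow>\<^sub>M emission_space"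
      using Cons.prems by (intro measurable_component_singleton) auto
    have [measurable]: "g \<in> count_space UNIV \<rightarrow>\<^sub>M count_space UNIV" by simp
    have [measurable]: "(\<lambda>\<omega>. map (\<lambda>t. g (fst (\<omega> t))) ts) \<in>
        PiM {0..<T} (\<lambda>_. emission_space) \<rightarrow>\<^sub>M count_space UNIV"
      using Cons by simp
    show ?case by simp measurable
  qed simp
  then show ?thesis by simp
qed

lemma measure_pmf_Abs_pmf_countable:
  fixes N :: "'x::countable measure"
  assumes "prob_space N" "sets N = UNIV"
  shows "measure_pmf (Abs_pmf N) = N"
proof -
  interpret prob_space N by fact
  have "AE x in N. x = y \<longrightarrow> measure N {y} \<noteq> 0" for y
    using assms(2) by (subst AE_iff_measurable[of "if measure N {y} = 0 then {y} else {}"])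
      (auto simp: emeasure_eq_measure sets_eq_imp_space_eq[of N "count_space UNIV"])
  then have "AE x in N. \<forall>y. x = y \<longrightarrow> measure N {y} \<noteq> 0"
    unfolding AE_all_countable by (rule allI)
  then have "AE x in N. measure N {x} \<noteq> 0" by simp
  then show ?thesis
    using assms by (intro Abs_pmf_inverse) auto
qed

lemma measure_pmf_observations:
  fixes M :: "('s, 'o::countable, 'a) npomdp" and g :: "'o \<times> 'o \<Rightarrow> 'o" and a T
  assumes "valid_npomdp M"
  defines "N \<equiv> distr (trajectory_dist M a T) (count_space UNIV)
    (\<lambda>\<omega>. map (\<lambda>t. g (fst (\<omega> t))) [0..<T])"
  shows "measure_pmf (Abs_pmf N) = N"
proof (rule measure_pmf_Abs_pmf_countable)
  have prob: "prob_space (trajectory_dist M a T)"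
    and sets: "sets (trajectory_dist M a T) = sets (PiM {0..<T} (\<lambda>_. emission_space))"
    using trajectory_dist_in[OF assms(1)] by (auto simp: space_prob_algebra)
  show "prob_space N"
    unfolding N_def
    by (intro prob_space.prob_space_distr prob)
      (simp add: measurable_observations measurable_cong_sets[OF sets refl])
qed (simp add: N_def)

lemma measure_pmf_clean_dist:
  fixes M :: "('s, 'o::countable, 'a) npomdp"
  assumes "valid_npomdp M"
  shows "measure_pmf (clean_dist M a T) = distr (trajectory_dist M a T) (count_space UNIV)
    (\<lambda>\<omega>. map (\<lambda>t. fst (fst (\<omega> t))) [0..<T])"
  unfolding clean_dist_def by (rule measure_pmf_observations[OF assms])

lemma measure_pmf_cluttered_dist:
  fixes M :: "('s, 'o::countable, 'a) npomdp"
  assumes "valid_npomdp M"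
  shows "measure_pmf (cluttered_dist M a T) = distr (trajectory_dist M a T) (count_space UNIV)
    (\<lambda>\<omega>. map (\<lambda>t. snd (fst (\<omega> t))) [0..<T])"
  unfolding cluttered_dist_def by (rule measure_pmf_observations[OF assms])

lemma length_clean_dist:
  fixes M :: "('s, 'o::countable, 'a) npomdp"
  assumes "valid_npomdp M" "xs \<in> set_pmf (clean_dist M a T)"
  shows "length xs = T"
proof -
  have sets: "sets (trajectory_dist M a T) = sets (PiM {0..<T} (\<lambda>_. emission_space))"
    using trajectory_dist_in[OF assms(1)] by (auto simp: space_prob_algebra)
  have "(\<lambda>\<omega>. map (\<lambda>t. fst (fst (\<omega> t))) [0..<T]) \<in> trajectory_dist M a T \<rightarrow>\<^sub>M count_space UNIV"
    by (simp add: measurable_observations measurable_cong_sets[OF sets refl])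
  then have "AE xs in measure_pmf (clean_dist M a T). length xs = T"
    unfolding measure_pmf_clean_dist[OF assms(1)] by (subst AE_distr_iff) auto
  then show ?thesis using assms(2) by (simp add: AE_measure_pmf_iff)
qed

lemma AE_trajectory_dist:
  fixes M :: "('s, 'o::countable, 'a) npomdp"
  assumes M: "valid_npomdp M"
  shows "AE \<omega> in trajectory_dist M a T. \<forall>t<T. snd (fst (\<omega> t)) = noise M (fst (fst (\<omega> t)))"
proof -
  let ?S = "PiM {0..<T} (\<lambda>_. state_space M)" and ?E = "PiM {0..<T} (\<lambda>_. emission_space)"
  let ?K = "\<lambda>s t. emission M (map a [0..<t]) (restrict s {0..<Suc t})"
  have sets: "sets (state_dist M a T) = sets ?S"
    using state_dist_in[OF M] by (auto simp: space_prob_algebra)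
  have K: "prob_space (?K s t) \<and> sets (?K s t) = sets emission_space"
    if "s \<in> space ?S" "t < T" for s t
  proof -
    have "restrict s {0..<Suc t} \<in> space (PiM {0..<Suc t} (\<lambda>_. state_space M))"
      using that by (auto simp: space_PiM PiE_iff)
    then show ?thesis
      using measurable_space[OF emission_in[OF M, of "map a [0..<t]"], of "restrict s {0..<Suc t}"]
      by (simp add: space_prob_algebra)
  qed
  have pred: "Measurable.pred ?E (\<lambda>\<omega>. \<forall>t<T. snd (fst (\<omega> t)) = noise M (fst (fst (\<omega> t))))"
  proof -
    have *: "Measurable.pred ?E (\<lambda>\<omega>. snd (fst (\<omega> t)) = noise M (fst (fst (\<omega> t))))" if "t < T" for t
    proof -
      have [measurable]: "(\<lambda>\<omega>. \<omega> t) \<in> ?E \<rightarrow>\<^sub>M emission_space"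
        using that by (intro measurable_component_singleton) auto
      have "(\<lambda>x. snd x = noise M (fst x)) \<in> count_space UNIV \<rightarrow>\<^sub>M count_space UNIV" by simp
      from measurable_compose[OF _ this, of "\<lambda>\<omega>. fst (\<omega> t)" ?E] show ?thesis by simp
    qed
    have "Measurable.pred ?E (\<lambda>\<omega>. \<forall>t\<in>{..<T}. snd (fst (\<omega> t)) = noise M (fst (fst (\<omega> t))))"
      using * by (intro pred_intros_finite) auto
    then show ?thesis by (simp add: Ball_def)
  qed
  have emit: "AE e in ?K s t. snd (fst e) = noise M (fst (fst e))" if st: "s \<in> space ?S" "t < T" for s t
  proof -
    let ?h = "map a [0..<t]" and ?s = "restrict s {0..<Suc t}"
    let ?P = "bind_pmf (observation M ?h ?s) (\<lambda>x. map_pmf (Pair x) (dirac (noise M) x))"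
    have s': "?s \<in> space (PiM {0..<Suc t} (\<lambda>_. state_space M))"
      using st by (auto simp: space_PiM PiE_iff)
    have "reward M ?h \<in> PiM {0..<Suc (length ?h)} (\<lambda>_. state_space M) \<rightarrow>\<^sub>M prob_algebra borel"
      using M unfolding valid_npomdp_def by (elim conjE) (rule spec)
    then have r: "reward M ?h \<in> PiM {0..<Suc t} (\<lambda>_. state_space M) \<rightarrow>\<^sub>M prob_algebra borel"
      by simp
    have "prob_space (reward M ?h ?s)"
      using measurable_space[OF r s'] by (simp add: space_prob_algebra)
    then interpret R: prob_space "reward M ?h ?s" .
    have "AE x in measure_pmf ?P. snd x = noise M (fst x)"
      by (auto simp: AE_measure_pmf_iff dirac_def)
    then have "AE x in distr (?K s t) (measure_pmf ?P) fst. snd x = noise M (fst x)"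
      by (simp only: emission_def R.distr_pair_fst)
    then have "AE e in ?K s t. (\<lambda>x. snd x = noise M (fst x)) (fst e)"
      by (rule AE_distrD[rotated]) (simp add: emission_def)
    then show ?thesis .
  qed
  have "AE \<omega> in PiM {0..<T} (?K s). \<forall>t<T. snd (fst (\<omega> t)) = noise M (fst (fst (\<omega> t)))"
    if s: "s \<in> space ?S" for s
  proof -
    have "AE \<omega> in PiM {0..<T} (?K s). snd (fst (\<omega> t)) = noise M (fst (fst (\<omega> t)))" if "t < T" for t
      using that K[OF s] emit[OF s that] by (intro AE_PiM_component) auto
    then have "AE \<omega> in PiM {0..<T} (?K s). \<forall>t\<in>{..<T}. snd (fst (\<omega> t)) = noise M (fst (fst (\<omega> t)))"
      by (intro AE_finite_allI) auto
    then show ?thesis by (simp add: Ball_def)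
  qed
  then show ?thesis
    unfolding trajectory_dist_def
    by (subst AE_bind[where B = ?E])
      (auto simp: measurable_cong_sets[OF sets refl] sets_eq_imp_space_eq[OF sets]
        intro!: measurable_prob_algebraD[OF emissions_in[OF M]] pred)
qed

lemma cluttered_dist_eq:
  fixes M :: "('s, 'o::countable, 'a) npomdp"
  assumes M: "valid_npomdp M"
  shows "cluttered_dist M a T = noised_dist (clean_dist M a T) (noise M)"
proof -
  let ?E = "PiM {0..<T} (\<lambda>_. emission_space)"
  have sets: "sets (trajectory_dist M a T) = sets ?E"
    using trajectory_dist_in[OF M] by (auto simp: space_prob_algebra)
  have meas: "(\<lambda>\<omega>. map (\<lambda>t. g (fst (\<omega> t))) [0..<T]) \<in> trajectory_dist M a T \<rightarrow>\<^sub>M count_space UNIV"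
    for g :: "'o \<times> 'o \<Rightarrow> 'o"
    by (simp add: measurable_observations measurable_cong_sets[OF sets refl])
  have "measure_pmf (cluttered_dist M a T) = distr (trajectory_dist M a T) (count_space UNIV)
      (\<lambda>\<omega>. map (noise M) (map (\<lambda>t. fst (fst (\<omega> t))) [0..<T]))"
    unfolding measure_pmf_cluttered_dist[OF M]
    using AE_trajectory_dist[OF M, where a = a and T = T] meas[of snd] meas[of "\<lambda>x. noise M (fst x)"]
    by (intro distr_cong_AE) (auto simp: comp_def)
  also have "\<dots> = measure_pmf (noised_dist (clean_dist M a T) (noise M))"
    unfolding noised_dist_eq map_pmf_rep_eq measure_pmf_clean_dist[OF M]
    using meas[of fst] by (subst distr_distr) (auto simp: comp_def)
  finally show ?thesis by (simp add: measure_pmf_inject)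
qed

end

theory Submission
  imports Defs
begin

text \<open>
  For Dirac kernels given by maps m and k, the loss is finite only if k inverts m on the cluttered
  observations. Both joint laws are then images under the injection xs \<open>\<mapsto>\<close> (xs, map k xs), so the loss
  is the relative entropy of the denoised law with respect to the clean one. It is nonnegative, and
  zero, a value attained by inverting the true noise, exactly if m turns the cluttered law into
  the clean one. An injective m with this property is the inverse of a homogeneous noise function.
\<close>

subsection \<open>Relative entropy of discrete distributions\<close>

text \<open>A set is null for a discrete law exactly if it misses the support.\<close>

lemma absolutely_continuous_measure_pmf_iff:
  "absolutely_continuous (measure_pmf Q) (measure_pmf P) \<longleftrightarrow> set_pmf P \<subseteq> set_pmf Q"
proof
  assume ac: "absolutely_continuous (measure_pmf Q) (measure_pmf P)"
  have "AE x in measure_pmf Q. x \<in> set_pmf Q"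
    by (simp add: AE_measure_pmf_iff)
  then have "AE x in measure_pmf P. x \<in> set_pmf Q"
    by (intro absolutely_continuous_AE[OF _ ac]) auto
  then show "set_pmf P \<subseteq> set_pmf Q"
    by (auto simp: AE_measure_pmf_iff)
next
  assume "set_pmf P \<subseteq> set_pmf Q"
  then show "absolutely_continuous (measure_pmf Q) (measure_pmf P)"
    by (auto simp: absolutely_continuous_def null_sets_def
        measure_pmf.emeasure_eq_measure measure_pmf_zero_iff)
qed

lemma density_pmf_ratio:
  assumes "set_pmf P \<subseteq> set_pmf Q"
  shows "density (measure_pmf Q) (\<lambda>x. ennreal (pmf P x / pmf Q x)) = measure_pmf P"
proof -
  \<comment> \<open>Off the support of \<open>Q\<close> the quotient takes the default value 0,
    which is correct because \<open>P\<close> has no mass there.\<close>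
  have "pmf Q x \<noteq> 0 \<or> pmf P x = 0" for x
    using assms by (auto simp: set_pmf_iff subset_iff)
  then have "ennreal (pmf Q x) * ennreal (pmf P x / pmf Q x) = ennreal (pmf P x)" for x
    by (auto simp flip: ennreal_mult)
  then show ?thesis
    unfolding measure_pmf_eq_density[of Q] measure_pmf_eq_density[of P]
    by (subst density_density_eq) (auto simp: mult.commute)
qed

text \<open>The Radon-Nikodym derivative is unique only up to \<open>Q\<close>-null sets, but every
  point of the support of \<open>P\<close> is an atom of \<open>Q\<close>, so almost sure equality
  is pointwise there.\<close>

lemma entropy_density_measure_pmf:
  assumes PQ: "set_pmf P \<subseteq> set_pmf Q" and x: "x \<in> set_pmf P"
  shows "entropy_density b (measure_pmf Q) (measure_pmf P) x = log b (pmf P x / pmf Q x)"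
proof -
  have "AE x in measure_pmf Q.
      ennreal (pmf P x / pmf Q x) = RN_deriv (measure_pmf Q) (measure_pmf P) x"
    by (intro measure_pmf.RN_deriv_unique density_pmf_ratio PQ) simp
  then have "RN_deriv (measure_pmf Q) (measure_pmf P) x = ennreal (pmf P x / pmf Q x)"
    using PQ x by (auto simp: AE_measure_pmf_iff)
  then show ?thesis
    by (simp add: entropy_density_def)
qed

lemma KL_div_eq:
  "KL_div P Q =
    (if set_pmf P \<subseteq> set_pmf Q \<and> integrable (measure_pmf P) (\<lambda>x. ln (pmf P x / pmf Q x))
     then ereal (\<integral>x. ln (pmf P x / pmf Q x) \<partial>measure_pmf P) else \<infinity>)"
proof (cases "set_pmf P \<subseteq> set_pmf Q")
  case True
  have "AE x in measure_pmf P.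
      entropy_density (exp 1) (measure_pmf Q) (measure_pmf P) x = ln (pmf P x / pmf Q x)"
    using entropy_density_measure_pmf[OF True] by (simp add: AE_measure_pmf_iff log_ln)
  moreover from this have "integrable (measure_pmf P)
        (entropy_density (exp 1) (measure_pmf Q) (measure_pmf P)) \<longleftrightarrow>
      integrable (measure_pmf P) (\<lambda>x. ln (pmf P x / pmf Q x))"
    by (intro integrable_cong_AE) auto
  ultimately show ?thesis
    using True by (auto simp: KL_div_def absolutely_continuous_measure_pmf_iff KL_divergence_def
        intro: integral_cong_AE)
qed (simp add: KL_div_def absolutely_continuous_measure_pmf_iff)

lemma KL_div_self: "KL_div P P = 0"
proof -
  have eq: "AE x in measure_pmf P. ln (pmf P x / pmf P x) = 0"
    by (auto simp: AE_measure_pmf_iff set_pmf_iff)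
  then have "integrable (measure_pmf P) (\<lambda>x. ln (pmf P x / pmf P x))"
    by (subst integrable_cong_AE[where g = "\<lambda>_. 0"]) auto
  moreover have "(\<integral>x. ln (pmf P x / pmf P x) \<partial>measure_pmf P) = 0"
    using eq by (intro integral_eq_zero_AE)
  ultimately show ?thesis
    by (simp add: KL_div_eq zero_ereal_def)
qed

text \<open>This is the strict form of Gibbs' inequality; where the integral formula does not apply,
  the divergence is infinite by definition.\<close>

lemma KL_div_pos:
  assumes "P \<noteq> Q"
  shows "0 < KL_div P Q"
proof (cases "set_pmf P \<subseteq> set_pmf Q \<and> integrable (measure_pmf P) (\<lambda>x. ln (pmf P x / pmf Q x))")
  case True
  let ?D = "\<lambda>x. pmf P x / pmf Q x"
  interpret information_space "measure_pmf Q" "exp 1"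
    by unfold_locales simp
  have dens: "density (measure_pmf Q) (\<lambda>x. ennreal (?D x)) = measure_pmf P"
    using True by (intro density_pmf_ratio) simp
  \<comment> \<open>Integrability under \<open>P\<close> becomes integrability of
    \<open>?D * log ?D\<close> under \<open>Q\<close>, the form in which \<open>KL_gt_0\<close> asks
    for it.\<close>
  have "integrable (density (measure_pmf Q) ?D) (\<lambda>x. log (exp 1) (?D x))"
    using True by (simp add: dens log_ln)
  then have int: "integrable (measure_pmf Q) (\<lambda>x. ?D x * log (exp 1) (?D x))"
    by (subst (asm) integrable_real_density) auto
  have "0 < KL_divergence (exp 1) (measure_pmf Q) (density (measure_pmf Q) ?D)"
    using assms int
    by (intro KL_gt_0) (auto simp: dens measure_pmf_inject measure_pmf.prob_space_axioms)
  also have "\<dots> = (\<integral>x. ln (?D x) \<partial>measure_pmf P)"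
    unfolding dens KL_divergence_def
    using True entropy_density_measure_pmf[of P Q]
    by (intro integral_cong_AE) (auto simp: AE_measure_pmf_iff log_ln)
  finally show ?thesis
    using True by (simp add: KL_div_eq)
qed (auto simp: KL_div_eq)

lemma KL_div_nonneg: "0 \<le> KL_div P Q"
  by (cases "P = Q") (auto simp: KL_div_self intro: less_imp_le KL_div_pos)

text \<open>An injection only relabels atoms, so the mass ratios are unchanged. This later removes
  the cluttered component from both joint laws.\<close>

lemma KL_div_map_pmf_inj:
  assumes "inj h"
  shows "KL_div (map_pmf h P) (map_pmf h Q) = KL_div P Q"
  using assms by (simp add: KL_div_eq pmf_map_inj' inj_image_subset_iff)

subsection \<open>Sequence distributions\<close>

lemma nth_in_occurring:
  assumes "xs \<in> set_pmf p" "t < T"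
  shows "xs ! t \<in> occurring T p"
  using assms by (auto simp: occurring_def marginal_def pmf_positive_iff)

text \<open>The set \<open>occurring T p\<close> sees only positions below \<open>T\<close>; the
  length hypothesis makes it contain every entry of a possible sequence.\<close>

lemma map_pmf_map_cong:
  assumes "\<And>xs. xs \<in> set_pmf p \<Longrightarrow> length xs = T"
    and "\<And>x. x \<in> occurring T p \<Longrightarrow> f x = g x"
  shows "map_pmf (map f) p = map_pmf (map g) p"
  using assms nth_in_occurring[of _ p _ T]
  by (intro map_pmf_cong refl) (force simp: in_set_conv_nth)

lemma map_pmf_map_inverse:
  assumes "\<And>xs. xs \<in> set_pmf p \<Longrightarrow> length xs = T"
    and "\<And>x. x \<in> occurring T p \<Longrightarrow> g (f x) = x"
  shows "map_pmf (map g) (map_pmf (map f) p) = p"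
  using map_pmf_map_cong[of p T "g \<circ> f" id] assms by (simp add: pmf.map_comp)

lemma occurring_map:
  assumes "\<And>xs. xs \<in> set_pmf p \<Longrightarrow> length xs = T"
  shows "occurring T (map_pmf (map f) p) = f ` occurring T p"
proof -
  have "set_pmf (marginal t (map_pmf (map f) p)) = f ` set_pmf (marginal t p)" if "t < T" for t
    using assms that by (force simp: marginal_def image_image)
  then show ?thesis
    by (fastforce simp: occurring_def pmf_positive_iff)
qed

lemma seq_kernel_restrict_dirac:
  assumes "\<And>x. x \<in> set xs \<Longrightarrow> x \<in> X"
  shows "seq_kernel (restrict (dirac f) X) xs = return_pmf (map f xs)"
proof -
  have "seq_kernel (restrict (dirac f) X) xs = seq_kernel (dirac f) xs"
    unfolding seq_kernel_def
    using assms by (intro arg_cong[where f = "map_pmf _"] Pi_pmf_cong) auto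
  then show ?thesis
    by (simp add: seq_kernel_dirac)
qed

text \<open>The parameter \<open>h\<close> leaves the order of the pair open, so that both joint
  laws of the loss are instances.\<close>

lemma bind_seq_kernel_restrict_dirac:
  assumes "\<And>xs. xs \<in> set_pmf p \<Longrightarrow> length xs = T"
  shows "bind_pmf p (\<lambda>xs. map_pmf (h xs) (seq_kernel (restrict (dirac f) (occurring T p)) xs)) =
    map_pmf (\<lambda>xs. h xs (map f xs)) p"
  unfolding map_pmf_def[of "\<lambda>xs. h xs (map f xs)"]
  using assms nth_in_occurring[of _ p _ T]
  by (intro bind_pmf_cong refl, subst seq_kernel_restrict_dirac) (force simp: in_set_conv_nth)+

subsection \<open>The loss of a pair of Dirac kernels\<close>

lemma KL_loss_dirac:
  assumes "\<And>xs. xs \<in> set_pmf p \<Longrightarrow> length xs = T"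
    and "\<And>ys. ys \<in> set_pmf p' \<Longrightarrow> length ys = T"
  shows "KL_loss p p' (restrict (dirac m) (occurring T p')) (restrict (dirac k) (occurring T p)) =
    KL_div (map_pmf (\<lambda>ys. (map m ys, ys)) p') (map_pmf (\<lambda>xs. (xs, map k xs)) p)"
  unfolding KL_loss_def
  using bind_seq_kernel_restrict_dirac[of p' T "\<lambda>ys xs. (xs, ys)" m]
    bind_seq_kernel_restrict_dirac[of p T Pair k] assms
  by simp

lemma KL_loss_dirac_inverse:
  assumes "\<And>xs. xs \<in> set_pmf p \<Longrightarrow> length xs = T"
    and len': "\<And>ys. ys \<in> set_pmf p' \<Longrightarrow> length ys = T"
    and inv: "\<And>y. y \<in> occurring T p' \<Longrightarrow> k (m y) = y"
  shows "KL_loss p p' (restrict (dirac m) (occurring T p')) (restrict (dirac k) (occurring T p)) =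
    KL_div (map_pmf (map m) p') p"
proof -
  have "map k (map m ys) = ys" if "ys \<in> set_pmf p'" for ys
    using that len' inv nth_in_occurring[OF that, of _ T]
    by (auto intro!: nth_equalityI)
  \<comment> \<open>The cluttered sequence is recovered from the denoised one, so the first law also
    lives on the graph of \<open>map k\<close>.\<close>
  then have "map_pmf (\<lambda>ys. (map m ys, ys)) p' = map_pmf (\<lambda>xs. (xs, map k xs)) (map_pmf (map m) p')"
    unfolding pmf.map_comp by (intro map_pmf_cong) auto
  then show ?thesis
    using assms by (simp add: KL_loss_dirac KL_div_map_pmf_inj inj_def)
qed

text \<open>Finite relative entropy forces inclusion of supports, and the second law is supported on
  the graph of \<open>map k\<close>. Reading off one entry gives the claim.\<close>

lemma KL_loss_dirac_finite:
  assumes len: "\<And>xs. xs \<in> set_pmf p \<Longrightarrow> length xs = T"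
    and len': "\<And>ys. ys \<in> set_pmf p' \<Longrightarrow> length ys = T"
    and fin: "KL_loss p p' (restrict (dirac m) (occurring T p')) (restrict (dirac k) (occurring T p)) \<noteq> \<infinity>"
    and y: "y \<in> occurring T p'"
  shows "k (m y) = y"
proof -
  have "set_pmf (map_pmf (\<lambda>ys. (map m ys, ys)) p') \<subseteq> set_pmf (map_pmf (\<lambda>xs. (xs, map k xs)) p)"
    using fin len len' by (auto simp: KL_loss_dirac KL_div_eq split: if_splits)
  then have sub: "map k (map m ys) = ys" if "ys \<in> set_pmf p'" for ys
    using that by auto
  obtain t ys where ys: "t < T" "ys \<in> set_pmf p'" "y = ys ! t"
    using y by (auto simp: occurring_def marginal_def pmf_positive_iff)
  have "map k (map m ys) ! t = ys ! t"
    using sub[OF ys(2)] by simp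
  with ys len' show ?thesis by simp
qed

section \<open>Minimizers of the loss\<close>

text \<open>The minimal value is 0. The left inverse \<open>k\<close> on the right records a noising
  kernel for which the loss is finite.\<close>

lemma solution_set_eq:
  assumes len: "\<And>xs. xs \<in> set_pmf p \<Longrightarrow> length xs = T"
    and inj: "inj_on f (occurring T p)"
    and p': "p' = map_pmf (map f) p"
  shows "solution_set T p p' =
    {restrict (dirac m) (occurring T p') | m.
       m \<in> occurring T p' \<rightarrow> occurring T p \<and> map_pmf (map m) p' = p \<and>
       (\<exists>k \<in> occurring T p \<rightarrow> occurring T p'. \<forall>y\<in>occurring T p'. k (m y) = y)}"
    (is "_ = ?R")
proof -
  let ?C = "occurring T p" and ?N = "occurring T p'"
  let ?L = "\<lambda>q. INF r \<in> dirac_kernels ?C ?N. KL_loss p p' q r"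
  have len': "length ys = T" if "ys \<in> set_pmf p'" for ys
    using that len by (auto simp: p')
  have N: "?N = f ` ?C"
    unfolding p' by (rule occurring_map) (rule len)
  have dirac: "q \<in> dirac_kernels ?N ?C" if "q \<in> ?R" for q
    using that by (auto simp: dirac_kernels_def)
  \<comment> \<open>An infinite loss satisfies the bound trivially; a finite one forces
    \<open>k\<close> to invert \<open>m\<close>, and then equality holds.\<close>
  have lower: "KL_div (map_pmf (map m) p') p \<le> ?L (restrict (dirac m) ?N)" for m
  proof (rule INF_greatest)
    fix r assume "r \<in> dirac_kernels ?C ?N"
    then obtain k where r: "r = restrict (dirac k) ?C"
      by (auto simp: dirac_kernels_def)
    show "KL_div (map_pmf (map m) p') p \<le> KL_loss p p' (restrict (dirac m) ?N) r"
    proof (cases "KL_loss p p' (restrict (dirac m) ?N) r = \<infinity>")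
      case False
      then have "k (m y) = y" if "y \<in> ?N" for y
        using KL_loss_dirac_finite[of p T p' m k y] len len' that r by auto
      then show ?thesis
        unfolding r by (subst KL_loss_dirac_inverse) (auto simp: len len')
    qed simp
  qed
  have nonneg: "0 \<le> ?L q" if "q \<in> dirac_kernels ?N ?C" for q
    using that lower KL_div_nonneg order_trans by (fastforce simp: dirac_kernels_def)
  have zero_iff: "?L q = 0 \<longleftrightarrow> q \<in> ?R" if q: "q \<in> dirac_kernels ?N ?C" for q
  proof
    assume L: "?L q = 0"
    obtain m where m: "m \<in> ?N \<rightarrow> ?C" "q = restrict (dirac m) ?N"
      using q by (auto simp: dirac_kernels_def)
    have "\<not> 0 < KL_div (map_pmf (map m) p') p"
      using lower[of m] L m by (auto simp: not_less)
    then have "map_pmf (map m) p' = p"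
      using KL_div_pos by blast
    \<comment> \<open>Attainment of the infimum is not presupposed: a value below infinity already
      yields some noising kernel with finite loss, hence a left inverse of \<open>m\<close>.\<close>
    moreover have "?L q < \<infinity>" using L by simp
    then obtain r where "r \<in> dirac_kernels ?C ?N" "KL_loss p p' q r < \<infinity>"
      unfolding INF_less_iff by blast
    then obtain k where "k \<in> ?C \<rightarrow> ?N" "KL_loss p p' q (restrict (dirac k) ?C) \<noteq> \<infinity>"
      by (auto simp: dirac_kernels_def)
    then have "\<exists>k \<in> ?C \<rightarrow> ?N. \<forall>y\<in>?N. k (m y) = y"
      using KL_loss_dirac_finite[of p T p' m] len len' m(2) by blast
    ultimately show "q \<in> ?R"
      using m by blast
  next
    assume "q \<in> ?R"
    then obtain m k where m: "q = restrict (dirac m) ?N" "map_pmf (map m) p' = p"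
      and k: "k \<in> ?C \<rightarrow> ?N" "\<And>y. y \<in> ?N \<Longrightarrow> k (m y) = y"
      by blast
    have "KL_loss p p' q (restrict (dirac k) ?C) = 0"
      unfolding m(1) by (subst KL_loss_dirac_inverse) (auto simp: len len' k m(2) KL_div_self)
    moreover have "restrict (dirac k) ?C \<in> dirac_kernels ?C ?N"
      using k by (auto simp: dirac_kernels_def)
    ultimately have "?L q \<le> 0"
      by (metis INF_lower)
    then show "?L q = 0"
      using nonneg[OF q] by (rule antisym)
  qed
  \<comment> \<open>Inverting the true noise \<open>f\<close>, with \<open>f\<close> itself as
    noising map, shows that the value 0 is attained.\<close>
  have "inv_into ?C f \<in> ?N \<rightarrow> ?C"
    by (auto simp: N intro: inv_into_into)
  moreover have "map_pmf (map (inv_into ?C f)) p' = p"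
    unfolding p' by (rule map_pmf_map_inverse[of _ T]) (auto simp: len inv_into_f_f[OF inj])
  moreover have "f \<in> ?C \<rightarrow> ?N" "\<forall>y\<in>?N. f (inv_into ?C f y) = y"
    by (auto simp: N f_inv_into_f)
  ultimately have attained: "restrict (dirac (inv_into ?C f)) ?N \<in> ?R"
    by blast
  show ?thesis
  proof (intro set_eqI iffI)
    fix q assume "q \<in> solution_set T p p'"
    then have q: "q \<in> dirac_kernels ?N ?C" and min: "\<And>q'. q' \<in> dirac_kernels ?N ?C \<Longrightarrow> \<not> ?L q' < ?L q"
      by (auto simp: solution_set_def is_arg_min_def)
    have "?L q \<le> 0"
      using min[OF dirac[OF attained]] zero_iff[OF dirac[OF attained]] attained
      by (simp add: not_less)
    then show "q \<in> ?R"
      using zero_iff[OF q] nonneg[OF q] by (metis antisym)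
  next
    fix q assume q: "q \<in> ?R"
    have "?L q = 0"
      using zero_iff[OF dirac[OF q]] q by blast
    then show "q \<in> solution_set T p p'"
      using dirac[OF q] nonneg unfolding solution_set_def is_arg_min_def
      by (auto simp: not_less)
  qed
qed

text \<open>Inversion matches denoising maps with noise functions: the posterior kernel of an
  injective \<open>g\<close> is the point mass at the inverse of \<open>g\<close>, by
  \<open>is_posterior_denoising_iff\<close>.\<close>

lemma inverse_eq_posterior_denoising:
  assumes len: "\<And>xs. xs \<in> set_pmf p \<Longrightarrow> length xs = T"
    and len': "\<And>ys. ys \<in> set_pmf p' \<Longrightarrow> length ys = T"
  shows "{restrict (dirac m) (occurring T p') | m.
       m \<in> occurring T p' \<rightarrow> occurring T p \<and> map_pmf (map m) p' = p \<and>
       (\<exists>k \<in> occurring T p \<rightarrow> occurring T p'. \<forall>y\<in>occurring T p'. k (m y) = y)} =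
    {q. \<exists>g \<in> noise_functions T p. map_pmf (map g) p = p' \<and> is_posterior_denoising T p g q}"
    (is "?L = ?R")
proof (intro set_eqI iffI)
  let ?C = "occurring T p" and ?N = "occurring T p'"
  fix q
  assume "q \<in> ?L"
  then obtain m k where m: "q = restrict (dirac m) ?N" "map_pmf (map m) p' = p"
    and k: "\<And>y. y \<in> ?N \<Longrightarrow> k (m y) = y"
    by blast
  \<comment> \<open>Since \<open>m\<close> carries \<open>p'\<close> to \<open>p\<close>, it maps
    the cluttered observations onto the clean ones; the left inverse \<open>k\<close> is therefore
    two-sided.\<close>
  have C: "?C = m ` ?N"
    using occurring_map[of p' T m] len' m(2) by simp
  \<comment> \<open>Cutting \<open>k\<close> down to \<open>?C\<close> makes it extensional, as
    \<open>noise_functions\<close> demands.\<close>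
  let ?g = "restrict k ?C"
  have g: "?g (m y) = y" if "y \<in> ?N" for y
    using that k C by auto
  have inj: "inj_on ?g ?C"
    using g by (auto simp: C inj_on_def)
  have image: "?g ` ?C = ?N"
    using g C by (auto simp: image_image)
  have "map_pmf (map ?g) p = p'"
    using map_pmf_map_inverse[of p' T ?g m] len' g m(2) by auto
  moreover have "?g \<in> noise_functions T p"
    using inj by (simp add: noise_functions_def)
  moreover have "inv_into ?C ?g y = m y" if "y \<in> ?N" for y
    using inj g[OF that] that C by (intro inv_into_f_eq) auto
  then have "q = (\<lambda>x\<in>?g ` ?C. return_pmf (inv_into ?C ?g x))"
    unfolding image m(1) by (auto simp: dirac_def fun_eq_iff)
  then have "is_posterior_denoising T p ?g q"
    using is_posterior_denoising_iff[OF len inj] by simp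
  ultimately show "q \<in> ?R" by blast
next
  let ?C = "occurring T p" and ?N = "occurring T p'"
  fix q
  assume "q \<in> ?R"
  then obtain g where inj: "inj_on g ?C" and g: "map_pmf (map g) p = p'"
    and post: "is_posterior_denoising T p g q"
    by (auto simp: noise_functions_def)
  have N: "?N = g ` ?C"
    using occurring_map[of p T g] len g by simp
  \<comment> \<open>Conversely, \<open>g\<close> serves as the left inverse of its own
    inverse.\<close>
  let ?m = "inv_into ?C g"
  have "q = restrict (dirac ?m) ?N"
    using post is_posterior_denoising_iff[of p T g q] len inj by (simp add: N dirac_def[abs_def])
  moreover have "?m \<in> ?N \<rightarrow> ?C"
    by (auto simp: N intro: inv_into_into)
  moreover have "map_pmf (map ?m) p' = p"
    unfolding g[symmetric] by (rule map_pmf_map_inverse[of _ T]) (auto simp: len inv_into_f_f[OF inj])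
  moreover have "g \<in> ?C \<rightarrow> ?N" "\<forall>y\<in>?N. g (?m y) = y"
    by (auto simp: N f_inv_into_f)
  ultimately show "q \<in> ?L" by blast
qed

theorem theorem1:
  fixes M :: "('s, 'o::countable, 'a) npomdp"
    and a :: "nat \<Rightarrow> 'a"
    and T :: nat
  assumes "valid_npomdp M"
  shows "solution_set T (clean_dist M a T) (cluttered_dist M a T) =
    {q. \<exists>g \<in> homogeneous_noise T (clean_dist M a T) (noise M).
          is_posterior_denoising T (clean_dist M a T) g q}"
proof -
  let ?p = "clean_dist M a T" and ?p' = "cluttered_dist M a T"
  have p': "?p' = map_pmf (map (noise M)) ?p"
    using cluttered_dist_eq[OF assms] by (simp add: noised_dist_eq)
  have len: "length xs = T" if "xs \<in> set_pmf ?p" for xs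
    using length_clean_dist[OF assms that] .
  then have len': "length ys = T" if "ys \<in> set_pmf ?p'" for ys
    using that by (auto simp: p')
  have inj: "inj_on (noise M) (occurring T ?p)"
    using assms by (auto simp: valid_npomdp_def intro: inj_on_subset)
  have "solution_set T ?p ?p' =
      {q. \<exists>g \<in> noise_functions T ?p. map_pmf (map g) ?p = ?p' \<and> is_posterior_denoising T ?p g q}"
    by (rule trans[OF solution_set_eq[OF _ inj p'] inverse_eq_posterior_denoising])
      (simp_all add: len len')
  \<comment> \<open>Homogeneity of \<open>g\<close> to \<open>noise M\<close> means precisely that
    \<open>g\<close> carries the clean law to the cluttered one.\<close>
  then show ?thesis
    by (auto simp: homogeneous_noise_def homogeneous_def noised_dist_eq p')
qed

end
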